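(* Let $E_1,\dots,E_m$ and $F$ be Banach spaces. Every Dunford–Pettis $m$-linear operator $T\in\mathcal{L}(E_1,\dots,E_m;F)$ is weakly Dunford–Pettis.
   Context: Banach spaces are over $\mathbb{K}=\mathbb{R}$ or $\mathbb{C}$; $F'$ is the topological dual of $F$; $\overset{w}{\to}$ denotes weak convergence of sequences (in $F'$ this means $\sigma(F',F'')$); $\mathcal{L}(E_1,\dots,E_m;F)$ is the space of continuous $m$-linear operators. $T\in\mathcal{L}(E_1,\dots,E_m;F)$ is Dunford–Pettis (at the origin) if for all sequences $x_j^{(i)}\overset{w}{\to}0$ in $E_i$ ($i=1,\dots,m$) one has $\|T(x_j^{(1)},\dots,x_j^{(m)})\|\to0$. It is weakly Dunford–Pettis if for all sequences $x_j^{(i)}\overset{w}{\to}0$ in $E_i$ ($i=1,\dots,m$) and all sequences $f_j\overset{w}{\to}0$ in $F'$ one has $f_j(T(x_j^{(1)},\dots,x_j^{(m)}))\to0$. *)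

theory Defs
  imports "HOL-Analysis.Analysis" "HOL-Algebra.Algebraic_Closure_Type"
begin

text \<open>
  The number and the underlying sets of the spaces \<open>E\<^sub>1, \<dots>, E\<^sub>m\<close> vary inside the statement, so normed
  spaces are carrier-based records over the \<open>module\<close> records of HOL-Algebra.  The fields \<open>mult\<close> and
  \<open>one\<close> inherited from \<open>ring\<close> are irrelevant.  Using one element type for all the \<open>E\<^sub>i\<close> is no
  restriction: the carriers are arbitrary subsets of it with unrelated structures, and finitely many
  types embed into a common sum type.

  The scalars are a type of class \<open>real_normed_field\<close>.  It has the instances \<open>real\<close> and \<open>complex\<close>,
  and (Gelfand--Mazur) every instance is isometrically isomorphic to one of them.
\<close>

record ('k, 'a) nspace = "('k, 'a) module" +
  vnorm :: "'a \<Rightarrow> real"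

locale normed_space = module "ring_of_type_algebra :: 'k ring" V
  for V :: "('k::real_normed_field, 'a) nspace" (structure) +
  assumes vnorm_nonneg: "x \<in> carrier V \<Longrightarrow> 0 \<le> vnorm V x"
    and vnorm_eq_0_iff: "x \<in> carrier V \<Longrightarrow> vnorm V x = 0 \<longleftrightarrow> x = \<zero>"
    and vnorm_triangle:
      "\<lbrakk>x \<in> carrier V; y \<in> carrier V\<rbrakk> \<Longrightarrow> vnorm V (x \<oplus> y) \<le> vnorm V x + vnorm V y"
    and vnorm_smult: "x \<in> carrier V \<Longrightarrow> vnorm V (c \<odot> x) = norm c * vnorm V x"

text \<open>The locale \<open>Metric_space\<close> demands symmetry and nonnegativity on the whole type, whence the
  value \<open>0\<close> off the carrier.\<close>

definition vdist :: "('k, 'a) nspace \<Rightarrow> 'a \<Rightarrow> 'a \<Rightarrow> real"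
  where "vdist V x y =
    (if x \<in> carrier V \<and> y \<in> carrier V then vnorm V (x \<ominus>\<^bsub>V\<^esub> y) else 0)"

abbreviation norm_topology :: "('k, 'a) nspace \<Rightarrow> 'a topology"
  where "norm_topology V \<equiv> Metric_space.mtopology (carrier V) (vdist V)"

locale banach_space = normed_space +
  assumes complete: "Metric_space.mcomplete (carrier V) (vdist V)"

text \<open>The topological dual with the operator norm.  Functionals are \<open>undefined\<close> off the carrier, so
  that equality in the dual is equality of functions on \<open>V\<close>.\<close>

definition dual_space :: "('k::real_normed_field, 'a) nspace \<Rightarrow> ('k, 'a \<Rightarrow> 'k) nspace"
  where "dual_space V =
   \<lparr> carrier = {f \<in> extensional (carrier V).
        (\<forall>x\<in>carrier V. \<forall>y\<in>carrier V. f (x \<oplus>\<^bsub>V\<^esub> y) = f x + f y) \<and>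
        (\<forall>c. \<forall>x\<in>carrier V. f (c \<odot>\<^bsub>V\<^esub> x) = c * f x) \<and>
        continuous_map (norm_topology V) euclidean f},
     monoid.mult = undefined,
     one = undefined,
     ring.zero = (\<lambda>x\<in>carrier V. 0),
     add = (\<lambda>f g. \<lambda>x\<in>carrier V. f x + g x),
     smult = (\<lambda>c f. \<lambda>x\<in>carrier V. c * f x),
     vnorm = (\<lambda>f. SUP x\<in>{x \<in> carrier V. vnorm V x \<le> 1}. norm (f x)) \<rparr>"

text \<open>For \<open>V = dual_space Y\<close> this is convergence in \<open>\<sigma>(Y', Y'')\<close>.\<close>

definition weakly_converges ::
    "('k::real_normed_field, 'a) nspace \<Rightarrow> (nat \<Rightarrow> 'a) \<Rightarrow> 'a \<Rightarrow> bool"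
  where "weakly_converges V x l \<longleftrightarrow>
    (\<forall>j. x j \<in> carrier V) \<and> l \<in> carrier V \<and>
    (\<forall>\<phi>\<in>carrier (dual_space V). (\<lambda>j. \<phi> (x j)) \<longlonglongrightarrow> \<phi> l)"

text \<open>Elements of \<open>E\<^sub>1 \<times> \<dots> \<times> E\<^sub>m\<close> are extensional functions on \<open>{1..m}\<close>.\<close>

definition multilinear_ops ::
    "nat \<Rightarrow> (nat \<Rightarrow> ('k, 'a) nspace) \<Rightarrow> ('k, 'b) nspace \<Rightarrow> ((nat \<Rightarrow> 'a) \<Rightarrow> 'b) set"
  where "multilinear_ops m E F =
    {T. (\<forall>x \<in> (\<Pi>\<^sub>E i\<in>{1..m}. carrier (E i)). T x \<in> carrier F) \<and>
        (\<forall>x \<in> (\<Pi>\<^sub>E i\<in>{1..m}. carrier (E i)). \<forall>i\<in>{1..m}. \<forall>u\<in>carrier (E i). \<forall>v\<in>carrier (E i).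
           T (x(i := u \<oplus>\<^bsub>E i\<^esub> v)) = T (x(i := u)) \<oplus>\<^bsub>F\<^esub> T (x(i := v))) \<and>
        (\<forall>x \<in> (\<Pi>\<^sub>E i\<in>{1..m}. carrier (E i)). \<forall>i\<in>{1..m}. \<forall>c. \<forall>u\<in>carrier (E i).
           T (x(i := c \<odot>\<^bsub>E i\<^esub> u)) = c \<odot>\<^bsub>F\<^esub> T (x(i := u))) \<and>
        continuous_map (product_topology (\<lambda>i. norm_topology (E i)) {1..m}) (norm_topology F) T}"

text \<open>Below, \<open>x i j\<close> is the \<open>j\<close>-th term of the sequence in \<open>E i\<close>.\<close>

definition dunford_pettis ::
    "nat \<Rightarrow> (nat \<Rightarrow> ('k::real_normed_field, 'a) nspace) \<Rightarrow> ('k, 'b) nspace \<Rightarrow> ((nat \<Rightarrow> 'a) \<Rightarrow> 'b) \<Rightarrow> bool"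
  where "dunford_pettis m E F T \<longleftrightarrow>
    (\<forall>x. (\<forall>i\<in>{1..m}. weakly_converges (E i) (x i) \<zero>\<^bsub>E i\<^esub>) \<longrightarrow>
         (\<lambda>j. vnorm F (T (\<lambda>i\<in>{1..m}. x i j))) \<longlonglongrightarrow> 0)"

definition weakly_dunford_pettis ::
    "nat \<Rightarrow> (nat \<Rightarrow> ('k::real_normed_field, 'a) nspace) \<Rightarrow> ('k, 'b) nspace \<Rightarrow> ((nat \<Rightarrow> 'a) \<Rightarrow> 'b) \<Rightarrow> bool"
  where "weakly_dunford_pettis m E F T \<longleftrightarrow>
    (\<forall>x f. (\<forall>i\<in>{1..m}. weakly_converges (E i) (x i) \<zero>\<^bsub>E i\<^esub>) \<and>
           weakly_converges (dual_space F) f \<zero>\<^bsub>dual_space F\<^esub> \<longrightarrow>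
         (\<lambda>j. f j (T (\<lambda>i\<in>{1..m}. x i j))) \<longlonglongrightarrow> 0)"

end

theory Submission
  imports Defs
begin

text \<open>
  Evaluation at a point of \<open>F\<close> is a continuous functional on \<open>F'\<close>, so a weakly null sequence \<open>f\<^sub>j\<close>
  in \<open>F'\<close> is pointwise null, hence norm bounded by the uniform boundedness principle.  Then
  \<open>\<bar>f\<^sub>j (T x\<^sub>j)\<bar> \<le> C \<parallel>T x\<^sub>j\<parallel> \<longlonglongrightarrow> 0\<close>.
\<close>

section \<open>The metric induced by a norm\<close>

context normed_space
begin

text \<open>Turns the record operations of the scalar ring into the type-class operations on
  \<open>'k\<close>, so that the module axioms become usable by arithmetic.\<close>

lemma scalar_ring_simps [simp]:
  "carrier (ring_of_type_algebra :: 'k ring) = UNIV"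
  "\<zero>\<^bsub>(ring_of_type_algebra :: 'k ring)\<^esub> = 0"
  "\<one>\<^bsub>(ring_of_type_algebra :: 'k ring)\<^esub> = 1"
  "a \<oplus>\<^bsub>(ring_of_type_algebra :: 'k ring)\<^esub> b = a + b"
  "a \<otimes>\<^bsub>(ring_of_type_algebra :: 'k ring)\<^esub> b = a * b"
  by (simp_all add: ring_of_type_algebra_def)

lemma smult_mem [simp, intro]: "x \<in> carrier V \<Longrightarrow> c \<odot> x \<in> carrier V"
  using smult_closed by simp

lemma smult_minus_one:
  assumes "x \<in> carrier V"
  shows "(-1) \<odot> x = \<ominus> x"
proof -
  have "(-1) \<odot> x \<oplus> x = (-1 + 1) \<odot> x"
    using assms smult_l_distr[of "-1" 1 x] smult_one[of x] by simp
  also have "\<dots> = \<zero>"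
    using assms smult_l_null[of x] by simp
  finally show ?thesis
    using assms M.minus_equality[of "(-1) \<odot> x" x] by simp
qed

lemma vnorm_a_inv: "x \<in> carrier V \<Longrightarrow> vnorm V (\<ominus> x) = vnorm V x"
  by (metis smult_minus_one vnorm_smult norm_minus_cancel norm_one mult_1)

lemma minus_add_cancel_right:
  assumes "x \<in> carrier V" "y \<in> carrier V"
  shows "(x \<ominus>\<^bsub>V\<^esub> y) \<oplus> y = x"
  using assms by (simp add: M.minus_eq M.a_assoc M.l_neg)

lemma Metric_space_vdist: "Metric_space (carrier V) (vdist V)"
proof
  fix x y z
  show "0 \<le> vdist V x y"
    by (simp add: vdist_def vnorm_nonneg)
  have "vnorm V (x \<ominus>\<^bsub>V\<^esub> y) = vnorm V (y \<ominus>\<^bsub>V\<^esub> x)" if "x \<in> carrier V" "y \<in> carrier V" for x y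
    using that vnorm_a_inv[of "x \<ominus>\<^bsub>V\<^esub> y"]
    by (simp add: M.minus_eq M.minus_add M.minus_minus M.a_comm)
  then show "vdist V x y = vdist V y x"
    by (simp add: vdist_def)
  assume x: "x \<in> carrier V" and y: "y \<in> carrier V"
  show "vdist V x y = 0 \<longleftrightarrow> x = y"
    using x y minus_add_cancel_right[OF x y] by (auto simp: vdist_def vnorm_eq_0_iff M.minus_eq M.r_neg)
  assume z: "z \<in> carrier V"
  have "x \<ominus>\<^bsub>V\<^esub> z = (x \<ominus>\<^bsub>V\<^esub> y) \<oplus> (y \<ominus>\<^bsub>V\<^esub> z)"
    using x y z minus_add_cancel_right[OF x y]
    by (metis M.minus_eq M.a_assoc M.minus_closed M.a_inv_closed)
  then show "vdist V x z \<le> vdist V x y + vdist V y z"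
    using x y z by (simp add: vdist_def vnorm_triangle)
qed

sublocale metric: Metric_space "carrier V" "vdist V"
  by (rule Metric_space_vdist)

lemma vdist_zero: "x \<in> carrier V \<Longrightarrow> vdist V \<zero> x = vnorm V x"
  by (simp add: vdist_def M.minus_eq vnorm_a_inv)

text \<open>Translation invariance, in the form that carries a ball about a point to a ball about
  zero.\<close>

lemma vdist_add: "y \<in> carrier V \<Longrightarrow> x \<in> carrier V \<Longrightarrow> vdist V y (y \<oplus> x) = vnorm V x"
  by (simp add: vdist_def M.minus_eq M.minus_add vnorm_a_inv M.r_neg1 M.r_neg2
      flip: M.a_assoc) (simp add: M.r_neg vnorm_a_inv)

section \<open>Bounded and continuous functionals\<close>

text \<open>Scaling a vector into the ball of radius \<open>r\<close> and pulling the scalar back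
  out by homogeneity. This one argument serves continuity at zero, the dual norm and the Baire
  argument.\<close>

lemma homogeneous_bound:
  fixes f :: "'a \<Rightarrow> 'k"
  assumes hom: "\<And>c x. x \<in> carrier V \<Longrightarrow> f (c \<odot> x) = c * f x"
    and "r > 0"
    and bd: "\<And>x. x \<in> carrier V \<Longrightarrow> vnorm V x < r \<Longrightarrow> norm (f x) \<le> K"
    and x: "x \<in> carrier V"
  shows "norm (f x) \<le> (2 * K / r) * vnorm V x"
proof (cases "vnorm V x = 0")
  case True
  then have "x = \<zero>"
    using x vnorm_eq_0_iff by simp
  then have "f x = 0"
    using hom[OF x, of 0] smult_l_null[OF x] by simp
  then show ?thesis
    using True by simp
next
  case False
  \<comment> \<open>The scaled vector has norm \<open>r / 2\<close>; the halving keeps it strictly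
    inside the ball and produces the factor 2 in the bound.\<close>
  define t where "t = r / (2 * vnorm V x)"
  have pos: "vnorm V x > 0"
    using False vnorm_nonneg[OF x] by simp
  then have t: "t > 0"
    using \<open>r > 0\<close> by (simp add: t_def)
  have "vnorm V (of_real t \<odot> x) < r"
    using x pos t \<open>r > 0\<close> by (simp add: vnorm_smult) (simp add: t_def)
  then have "t * norm (f x) \<le> K"
    using bd[of "of_real t \<odot> x"] x t by (simp add: hom norm_mult)
  then show ?thesis
    using pos \<open>r > 0\<close> by (simp add: t_def field_simps)
qed

text \<open>Replaces continuity in \<open>dual_space\<close> by an inequality, since the two agree
  for linear functionals. Closure properties and norm estimates then need no topology.\<close>

lemma dual_functional_iff:
  fixes f :: "'a \<Rightarrow> 'k"
  shows "f \<in> carrier (dual_space V) \<longleftrightarrow>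
    f \<in> extensional (carrier V) \<and>
    (\<forall>x\<in>carrier V. \<forall>y\<in>carrier V. f (x \<oplus> y) = f x + f y) \<and>
    (\<forall>c. \<forall>x\<in>carrier V. f (c \<odot> x) = c * f x) \<and>
    (\<exists>C. \<forall>x\<in>carrier V. norm (f x) \<le> C * vnorm V x)"
proof -
  have "continuous_map metric.mtopology euclidean f \<longleftrightarrow>
      (\<exists>C. \<forall>x\<in>carrier V. norm (f x) \<le> C * vnorm V x)" (is "?L \<longleftrightarrow> ?R")
    if add: "\<And>x y. x \<in> carrier V \<Longrightarrow> y \<in> carrier V \<Longrightarrow> f (x \<oplus> y) = f x + f y"
      and hom: "\<And>c x. x \<in> carrier V \<Longrightarrow> f (c \<odot> x) = c * f x"
  proof -
    have cont: "?L \<longleftrightarrow> (\<forall>a\<in>carrier V. \<forall>\<epsilon>>0. \<exists>\<delta>>0.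
        \<forall>x. x \<in> carrier V \<and> vdist V a x < \<delta> \<longrightarrow> dist (f a) (f x) < \<epsilon>)"
      using metric.metric_continuous_map[OF Met_TC.Metric_space_axioms, of f] by simp
    have f0: "f \<zero> = 0"
      using add[of \<zero> \<zero>] by simp
    show ?thesis
    proof
      assume ?L
      \<comment> \<open>Continuity at zero, with \<epsilon> = 1, bounds \<open>f\<close> by 1 on a
        ball about zero.\<close>
      then obtain \<delta> where \<delta>: "\<delta> > 0"
        "\<And>x. x \<in> carrier V \<Longrightarrow> vdist V \<zero> x < \<delta> \<Longrightarrow> dist (f \<zero>) (f x) < 1"
        unfolding cont by (metis M.zero_closed zero_less_one)
      then have "norm (f x) \<le> (2 * 1 / \<delta>) * vnorm V x" if "x \<in> carrier V" for x
        by (intro homogeneous_bound hom that) (auto simp: f0 vdist_zero less_imp_le)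
      then show ?R
        by blast
    next
      assume ?R
      then obtain C where C: "\<And>x. x \<in> carrier V \<Longrightarrow> norm (f x) \<le> C * vnorm V x"
        by blast
      \<comment> \<open>Linearity reduces the difference of two values to the value at
        \<open>a - x\<close>. The absolute value is there because \<open>C\<close> may be negative
        when the space is trivial.\<close>
      have lip: "dist (f a) (f x) \<le> \<bar>C\<bar> * vdist V a x" if "a \<in> carrier V" "x \<in> carrier V" for a x
      proof -
        have "f a = f (a \<ominus>\<^bsub>V\<^esub> x) + f x"
          using that add[of "a \<ominus>\<^bsub>V\<^esub> x" x] by (simp add: minus_add_cancel_right)
        then have "dist (f a) (f x) = norm (f (a \<ominus>\<^bsub>V\<^esub> x))"
          by (simp add: dist_norm)
        also have "\<dots> \<le> C * vnorm V (a \<ominus>\<^bsub>V\<^esub> x)"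
          using that by (simp add: C)
        also have "\<dots> \<le> \<bar>C\<bar> * vnorm V (a \<ominus>\<^bsub>V\<^esub> x)"
          using that by (simp add: mult_right_mono vnorm_nonneg)
        finally show ?thesis
          using that by (simp add: vdist_def)
      qed
      show ?L
        unfolding cont
      proof (intro ballI allI impI)
        fix a and \<epsilon> :: real
        assume a: "a \<in> carrier V" and "\<epsilon> > 0"
        \<comment> \<open>Adding 1 keeps the divisor positive even if \<open>C = 0\<close>.\<close>
        have "dist (f a) (f x) < \<epsilon>" if "x \<in> carrier V" "vdist V a x < \<epsilon> / (\<bar>C\<bar> + 1)" for x
        proof -
          have "(\<bar>C\<bar> + 1) * vdist V a x < \<epsilon>"
            using that(2) by (simp add: field_simps)
          moreover have "\<bar>C\<bar> * vdist V a x \<le> (\<bar>C\<bar> + 1) * vdist V a x"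
            by (simp add: mult_right_mono)
          ultimately show ?thesis
            using lip[OF a that(1)] by linarith
        qed
        then show "\<exists>\<delta>>0. \<forall>x. x \<in> carrier V \<and> vdist V a x < \<delta> \<longrightarrow> dist (f a) (f x) < \<epsilon>"
          using \<open>\<epsilon> > 0\<close> by (intro exI[of _ "\<epsilon> / (\<bar>C\<bar> + 1)"]) auto
      qed
    qed
  qed
  then show ?thesis
    by (auto simp: dual_space_def)
qed

section \<open>The operator norm\<close>

lemma dual_space_simps [simp]:
  "\<zero>\<^bsub>dual_space V\<^esub> = (\<lambda>x\<in>carrier V. 0)"
  "f \<oplus>\<^bsub>dual_space V\<^esub> g = (\<lambda>x\<in>carrier V. f x + g x)"
  "c \<odot>\<^bsub>dual_space V\<^esub> f = (\<lambda>x\<in>carrier V. c * f x)"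
  by (simp_all add: dual_space_def)

lemma vnorm_dual: "vnorm (dual_space V) f = (SUP x\<in>{x \<in> carrier V. vnorm V x \<le> 1}. norm (f x))"
  by (simp add: dual_space_def)

lemma vnorm_zero [simp]: "vnorm V \<zero> = 0"
  by (simp add: vnorm_eq_0_iff)

text \<open>A real supremum is an upper bound only if the set is bounded above; this makes the
  \<open>SUP\<close> in the dual norm meaningful.\<close>

lemma dual_bdd_above:
  assumes "f \<in> carrier (dual_space V)"
  shows "bdd_above ((\<lambda>x. norm (f x)) ` {x \<in> carrier V. vnorm V x \<le> 1})"
proof -
  obtain C where C: "\<And>x. x \<in> carrier V \<Longrightarrow> norm (f x) \<le> C * vnorm V x"
    using assms unfolding dual_functional_iff by blast
  have "norm (f x) \<le> \<bar>C\<bar>" if "x \<in> carrier V" "vnorm V x \<le> 1" for x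
  proof -
    have "C * vnorm V x \<le> \<bar>C\<bar> * 1"
      using that by (intro mult_mono) (auto simp: vnorm_nonneg)
    then show ?thesis
      using C[OF that(1)] by simp
  qed
  then show ?thesis
    by (auto intro!: bdd_aboveI2)
qed

lemma dual_norm_upper:
  assumes "f \<in> carrier (dual_space V)" "x \<in> carrier V" "vnorm V x \<le> 1"
  shows "norm (f x) \<le> vnorm (dual_space V) f"
  unfolding vnorm_dual using assms by (intro cSUP_upper dual_bdd_above) auto

lemma dual_norm_least:
  assumes "\<And>x. x \<in> carrier V \<Longrightarrow> vnorm V x \<le> 1 \<Longrightarrow> norm (f x) \<le> K"
  shows "vnorm (dual_space V) f \<le> K"
  unfolding vnorm_dual
proof (rule cSUP_least)
  \<comment> \<open>The least-upper-bound rule requires a nonempty unit ball; zero is a member in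
    every space.\<close>
  have "\<zero> \<in> {x \<in> carrier V. vnorm V x \<le> 1}"
    by simp
  then show "{x \<in> carrier V. vnorm V x \<le> 1} \<noteq> {}"
    by blast
qed (use assms in auto)

lemma dual_norm_nonneg:
  "f \<in> carrier (dual_space V) \<Longrightarrow> 0 \<le> vnorm (dual_space V) f"
  using dual_norm_upper[of f \<zero>] order_trans[OF norm_ge_zero[of "f \<zero>"]] by simp

text \<open>The factor \<open>2\<close> is not sharp; it comes from scaling into the open unit ball, and any constant
  suffices below.\<close>

lemma dual_norm_bound:
  assumes f: "f \<in> carrier (dual_space V)" and x: "x \<in> carrier V"
  shows "norm (f x) \<le> 2 * vnorm (dual_space V) f * vnorm V x"
proof -
  have "norm (f x) \<le> (2 * vnorm (dual_space V) f / 1) * vnorm V x"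
    using f by (intro homogeneous_bound x dual_norm_upper) (auto simp: dual_functional_iff)
  then show ?thesis
    by simp
qed

lemma dual_add_closed:
  assumes f: "f \<in> carrier (dual_space V)" and g: "g \<in> carrier (dual_space V)"
  shows "(\<lambda>x\<in>carrier V. f x + g x) \<in> carrier (dual_space V)"
proof -
  have "norm (f x + g x) \<le> (2 * vnorm (dual_space V) f + 2 * vnorm (dual_space V) g) * vnorm V x"
    if "x \<in> carrier V" for x
    using dual_norm_bound[OF f that] dual_norm_bound[OF g that] norm_triangle_ineq[of "f x" "g x"]
    by (simp add: algebra_simps)
  then have "\<exists>C. \<forall>x\<in>carrier V. norm (f x + g x) \<le> C * vnorm V x"
    by blast
  then show ?thesis
    using f g by (simp add: dual_functional_iff algebra_simps)
qed

lemma dual_smult_closed: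
  assumes f: "f \<in> carrier (dual_space V)"
  shows "(\<lambda>x\<in>carrier V. c * f x) \<in> carrier (dual_space V)"
proof -
  have "norm (c * f x) \<le> (norm c * (2 * vnorm (dual_space V) f)) * vnorm V x"
    if "x \<in> carrier V" for x
    using dual_norm_bound[OF f that] by (simp add: norm_mult mult_left_mono mult.assoc)
  then have "\<exists>C. \<forall>x\<in>carrier V. norm (c * f x) \<le> C * vnorm V x"
    by blast
  then show ?thesis
    using f by (simp add: dual_functional_iff algebra_simps)
qed

lemma dual_zero_closed: "(\<lambda>x\<in>carrier V. 0) \<in> carrier (dual_space V)"
  by (auto simp: dual_functional_iff intro!: exI[of _ 0])

text \<open>Handles the points off the carrier when two functionals are shown equal as
  functions.\<close>

lemma dual_undefined: "f \<in> carrier (dual_space V) \<Longrightarrow> x \<notin> carrier V \<Longrightarrow> f x = undefined"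
  by (auto simp: dual_functional_iff extensional_def)

section \<open>The dual as a normed space\<close>

lemma abelian_group_dual: "abelian_group (dual_space V)"
proof (rule abelian_groupI)
  fix f
  assume f: "f \<in> carrier (dual_space V)"
  show "\<exists>g\<in>carrier (dual_space V). g \<oplus>\<^bsub>dual_space V\<^esub> f = \<zero>\<^bsub>dual_space V\<^esub>"
    \<comment> \<open>The additive inverse of \<open>f\<close> is its multiple by -1.\<close>
    using dual_smult_closed[OF f, of "-1"] by (rule bexI[rotated]) (simp cong: restrict_cong)
qed (simp_all add: dual_add_closed dual_zero_closed dual_undefined add_ac fun_eq_iff)

lemma module_dual: "module (ring_of_type_algebra :: 'k ring) (dual_space V)"
  by (rule moduleI[OF cring_from_type_algebra abelian_group_dual])
    (auto simp: dual_smult_closed algebra_simps dual_undefined fun_eq_iff)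

text \<open>One half of homogeneity; the other half follows by using it again for the inverse
  scalar.\<close>

lemma dual_norm_smult_le:
  assumes f: "f \<in> carrier (dual_space V)"
  shows "vnorm (dual_space V) (c \<odot>\<^bsub>dual_space V\<^esub> f) \<le> norm c * vnorm (dual_space V) f"
  by (rule dual_norm_least) (simp add: norm_mult mult_left_mono dual_norm_upper f)

lemma normed_space_dual: "normed_space (dual_space V)"
proof (intro normed_space.intro module_dual normed_space_axioms.intro)
  fix f
  assume f: "f \<in> carrier (dual_space V)"
  show "0 \<le> vnorm (dual_space V) f"
    by (rule dual_norm_nonneg[OF f])
  show "vnorm (dual_space V) f = 0 \<longleftrightarrow> f = \<zero>\<^bsub>dual_space V\<^esub>"
  proof
    assume "vnorm (dual_space V) f = 0"
    then have "f x = 0" if "x \<in> carrier V" for x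
      using dual_norm_bound[OF f that] by simp
    then show "f = \<zero>\<^bsub>dual_space V\<^esub>"
      by (auto simp: fun_eq_iff dual_undefined[OF f])
  next
    assume "f = \<zero>\<^bsub>dual_space V\<^esub>"
    then have "vnorm (dual_space V) f \<le> 0"
      by (intro dual_norm_least) simp
    then show "vnorm (dual_space V) f = 0"
      using dual_norm_nonneg[OF f] by simp
  qed
  show "vnorm (dual_space V) (c \<odot>\<^bsub>dual_space V\<^esub> f) = norm c * vnorm (dual_space V) f" for c
  proof (rule antisym[OF dual_norm_smult_le[OF f]])
    show "norm c * vnorm (dual_space V) f \<le> vnorm (dual_space V) (c \<odot>\<^bsub>dual_space V\<^esub> f)"
    proof (cases "c = 0")
      case True
      then show ?thesis
        using dual_norm_nonneg[OF dual_smult_closed[OF f, of c]] by simp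
    next
      case False
      \<comment> \<open>Writing \<open>f\<close> as \<open>inverse c\<close> times \<open>c\<close>
        times \<open>f\<close> turns the upper estimate for \<open>inverse c\<close> into the lower
        estimate for \<open>c\<close>.\<close>
      have "inverse c \<odot>\<^bsub>dual_space V\<^esub> (c \<odot>\<^bsub>dual_space V\<^esub> f) = f"
        using False by (auto simp: fun_eq_iff dual_undefined[OF f])
      then have "vnorm (dual_space V) f
          \<le> norm (inverse c) * vnorm (dual_space V) (c \<odot>\<^bsub>dual_space V\<^esub> f)"
        using dual_norm_smult_le[OF dual_smult_closed[OF f, of c], of "inverse c"] by simp
      then show ?thesis
        using False by (simp add: norm_divide field_simps)
    qed
  qed
  fix g
  assume g: "g \<in> carrier (dual_space V)"
  show "vnorm (dual_space V) (f \<oplus>\<^bsub>dual_space V\<^esub> g)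
      \<le> vnorm (dual_space V) f + vnorm (dual_space V) g"
  proof (rule dual_norm_least)
    fix x
    assume "x \<in> carrier V" "vnorm V x \<le> 1"
    then show "norm ((f \<oplus>\<^bsub>dual_space V\<^esub> g) x) \<le> vnorm (dual_space V) f + vnorm (dual_space V) g"
      using dual_norm_upper[OF f] dual_norm_upper[OF g]
      by (simp add: norm_triangle_le add_mono)
  qed
qed

section \<open>Evaluations and weak convergence in the dual\<close>

text \<open>This is the canonical map into the bidual. The estimate for \<open>f y\<close>, read as
  a bound in \<open>f\<close> with \<open>y\<close> fixed, gives its continuity.\<close>

lemma evaluation_in_bidual:
  assumes "y \<in> carrier V"
  shows "(\<lambda>f\<in>carrier (dual_space V). f y) \<in> carrier (dual_space (dual_space V))"
proof -
  interpret D: normed_space "dual_space V"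
    by (rule normed_space_dual)
  have "norm (f y) \<le> (2 * vnorm V y) * vnorm (dual_space V) f" if "f \<in> carrier (dual_space V)" for f
    using dual_norm_bound[OF that assms] by (simp add: mult_ac)
  then have "\<exists>C. \<forall>f\<in>carrier (dual_space V). norm (f y) \<le> C * vnorm (dual_space V) f"
    by blast
  then show ?thesis
    using assms by (simp add: D.dual_functional_iff dual_add_closed dual_smult_closed)
qed

text \<open>Weak convergence in the dual implies weak-star convergence: evaluations are among the
  test functionals.\<close>

lemma weakly_converges_dual_pointwise:
  assumes "weakly_converges (dual_space V) f g" "y \<in> carrier V"
  shows "(\<lambda>j. f j y) \<longlonglongrightarrow> g y"
proof -
  have mem: "f j \<in> carrier (dual_space V)" "g \<in> carrier (dual_space V)" for j
    using assms(1) by (auto simp: weakly_converges_def)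
  have "(\<lambda>j. (\<lambda>f\<in>carrier (dual_space V). f y) (f j)) \<longlonglongrightarrow> (\<lambda>f\<in>carrier (dual_space V). f y) g"
    using assms(1) evaluation_in_bidual[OF assms(2)] unfolding weakly_converges_def by blast
  then show ?thesis
    by (simp add: mem)
qed

end

section \<open>The uniform boundedness principle\<close>

text \<open>Baire category: pointwise boundedness covers the space by the closed sets
  \<open>A n\<close>, so by completeness some \<open>A n\<close> contains a ball, on which all
  \<open>f j\<close> share one bound.\<close>

lemma (in banach_space) uniform_boundedness:
  fixes f :: "nat \<Rightarrow> 'a \<Rightarrow> 'b"
  assumes f: "\<And>j. f j \<in> carrier (dual_space V)"
    and bd: "\<And>y. y \<in> carrier V \<Longrightarrow> bounded (range (\<lambda>j. f j y))"
  obtains C where "\<And>j y. y \<in> carrier V \<Longrightarrow> norm (f j y) \<le> C * vnorm V y"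
proof -
  define A where "A n = {y \<in> carrier V. \<forall>j. norm (f j y) \<le> real n}" for n
  have closed: "closedin metric.mtopology (A n)" for n
  proof -
    \<comment> \<open>For a single \<open>j\<close> the condition is the preimage of a closed ball
      under a continuous map; \<open>A n\<close> is the intersection over all
      \<open>j\<close>.\<close>
    have "closedin metric.mtopology {y \<in> topspace metric.mtopology. f j y \<in> cball 0 (real n)}" for j
      using f[of j] by (intro closedin_continuous_map_preimage[of _ euclidean]) (auto simp: dual_space_def)
    then have "closedin metric.mtopology (\<Inter>j. {y \<in> topspace metric.mtopology. f j y \<in> cball 0 (real n)})"
      by (intro closedin_INT) auto
    also have "(\<Inter>j. {y \<in> topspace metric.mtopology. f j y \<in> cball 0 (real n)}) = A n"
      by (auto simp: A_def)
    finally show ?thesis .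
  qed
  have "(\<Union>n. A n) = carrier V"
  proof
    show "carrier V \<subseteq> (\<Union>n. A n)"
    proof
      fix y
      assume y: "y \<in> carrier V"
      obtain B where "\<And>j. norm (f j y) \<le> B"
        using bd[OF y] by (auto simp: bounded_iff)
      moreover obtain n where "B \<le> real n"
        using real_arch_simple by blast
      ultimately have "y \<in> A n"
        using y by (auto simp: A_def intro: order_trans)
      then show "y \<in> (\<Union>n. A n)"
        by blast
    qed
  qed (auto simp: A_def)
  \<comment> \<open>The union is the whole space, hence its own interior, and it contains
    zero.\<close>
  then have "metric.mtopology interior_of (\<Union>n. A n) \<noteq> {}"
    using interior_of_topspace[of metric.mtopology] M.zero_closed by auto
  \<comment> \<open>Baire's theorem by contraposition: if every \<open>A n\<close> had empty
    interior, so would the countable union.\<close>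
  then obtain n where "metric.mtopology interior_of (A n) \<noteq> {}"
    using metric.metric_Baire_category_alt[OF complete, of "range A"] closed by auto
  then obtain y0 r where y0: "y0 \<in> carrier V" and r: "r > 0" "metric.mball y0 r \<subseteq> A n"
    by (auto simp: metric.in_interior_of_mball)
  have "norm (f j x) \<le> 2 * real n" if x: "x \<in> carrier V" "vnorm V x < r" for j x
  proof -
    \<comment> \<open>Recentring: both \<open>y0 \<oplus> x\<close> and \<open>y0\<close> lie in the
      ball about \<open>y0\<close>, and the difference of their values is \<open>f j x\<close>. Two
      bounds \<open>n\<close> give \<open>2 * n\<close> on the ball about zero.\<close>
    have "y0 \<oplus> x \<in> A n" "y0 \<in> A n"
      using r x y0 by (auto simp: vdist_add subset_eq)
    then have "norm (f j (y0 \<oplus> x)) \<le> real n" "norm (f j y0) \<le> real n"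
      by (auto simp: A_def)
    moreover have "f j x = f j (y0 \<oplus> x) - f j y0"
      using f[of j] x y0 by (simp add: dual_functional_iff)
    ultimately show ?thesis
      using norm_triangle_ineq4[of "f j (y0 \<oplus> x)" "f j y0"] by simp
  qed
  \<comment> \<open>Scaling with \<open>K = 2 * n\<close>; neither \<open>n\<close> nor
    \<open>r\<close> depends on \<open>j\<close>, so the constant is uniform.\<close>
  then have "norm (f j y) \<le> (2 * (2 * real n) / r) * vnorm V y" if "y \<in> carrier V" for j y
    using f[of j] r(1) that by (intro homogeneous_bound) (auto simp: dual_functional_iff)
  then show thesis
    using that by blast
qed

section \<open>Weakly null functionals along the image sequence\<close>

theorem proposition3p3:
  fixes m :: nat
    and E :: "nat \<Rightarrow> ('k::real_normed_field, 'a) nspace"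
    and F :: "('k, 'b) nspace"
    and T :: "(nat \<Rightarrow> 'a) \<Rightarrow> 'b"
  assumes "m \<ge> 1"
    and "\<And>i. i \<in> {1..m} \<Longrightarrow> banach_space (E i)"
    and "banach_space F"
    and "T \<in> multilinear_ops m E F"
    and "dunford_pettis m E F T"
  shows "weakly_dunford_pettis m E F T"
  unfolding weakly_dunford_pettis_def
proof (intro allI impI, elim conjE)
  fix x f
  assume x: "\<forall>i\<in>{1..m}. weakly_converges (E i) (x i) \<zero>\<^bsub>E i\<^esub>"
    and f: "weakly_converges (dual_space F) f \<zero>\<^bsub>dual_space F\<^esub>"
  interpret F: banach_space F
    by fact
  let ?y = "\<lambda>j. T (\<lambda>i\<in>{1..m}. x i j)"
  have "f j \<in> carrier (dual_space F)" for j
    using f by (simp add: weakly_converges_def)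
  \<comment> \<open>For fixed \<open>y\<close> the scalars \<open>f j y\<close> converge, and
    convergent sequences are bounded.\<close>
  moreover have "bounded (range (\<lambda>j. f j y))" if "y \<in> carrier F" for y
    using F.weakly_converges_dual_pointwise[OF f that] by (rule convergent_imp_bounded)
  \<comment> \<open>Pointwise convergence alone does not settle the claim, because the argument
    \<open>?y j\<close> moves with \<open>j\<close>; a constant independent of \<open>j\<close>
    does.\<close>
  ultimately obtain C where C: "\<And>j y. y \<in> carrier F \<Longrightarrow> norm (f j y) \<le> C * vnorm F y"
    using F.uniform_boundedness by blast
  \<comment> \<open>Membership in the product puts \<open>?y j\<close> into the carrier of
    \<open>F\<close>, the only place where the bound by \<open>C\<close> is known.\<close>
  have "(\<lambda>i\<in>{1..m}. x i j) \<in> (\<Pi>\<^sub>E i\<in>{1..m}. carrier (E i))" for j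
    using x by (auto simp: weakly_converges_def)
  then have "?y j \<in> carrier F" for j
    using assms(4) by (simp add: multilinear_ops_def)
  then have bound: "norm (f j (?y j)) \<le> C * vnorm F (?y j)" for j
    by (rule C)
  have "(\<lambda>j. vnorm F (?y j)) \<longlonglongrightarrow> 0"
    using assms(5) x by (simp add: dunford_pettis_def)
  then have "(\<lambda>j. C * vnorm F (?y j)) \<longlonglongrightarrow> 0"
    by (rule tendsto_mult_right_zero)
  then show "(\<lambda>j. f j (?y j)) \<longlonglongrightarrow> 0"
    by (rule Lim_null_comparison[rotated]) (use bound in simp)
qed

end
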